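(* Let $k$ be a field, $S=k[x_1,\ldots,x_n]$, let $M$ be a nonzero proper monomial ideal of $S$ with minimal monomial generating set $G$, and let $\mathbb{F}$ be a minimal free resolution of $S/M$. Let $\operatorname{lcm}(G)=x_1^{\alpha_1}\cdots x_n^{\alpha_n}$, and let $1\le i_1<\cdots<i_q\le n$, where $1\le q\le n$. Suppose that: (i) $G$ contains a dominant set $\{d_1,\ldots,d_q\}$ (of cardinality $q$) such that, for all $j=1,\ldots,q$, $d_j$ is dominant in $x_{i_j}$, and $x_{i_j}$ appears with exponent $\alpha_{i_j}$ in the factorization of $d_j$. (ii) Every monomial in $G$ is divisible by at least one of $x_{i_1}^{\alpha_{i_1}},\ldots,x_{i_q}^{\alpha_{i_q}}$. Then there is a Taylor symbol $[\sigma]$ in the basis of $\mathbb{F}$ such that $\operatorname{hdeg}[\sigma]=q$ and $\operatorname{mdeg}[\sigma]=x_1^{\lambda_1}\cdots x_n^{\lambda_n}$, where $\lambda_j=\alpha_j$ if $j\in\{i_1,\ldots,i_q\}$ and $\lambda_j\le\alpha_j$ if $j\notin\{i_1,\ldots,i_q\}$.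
   Context: Dominance: if $L$ is a finite set of monomials, $m\in L$ is dominant (in $L$) in the variable $x$ if for every $m'\in L\setminus\{m\}$ the exponent of $x$ in $m$ is strictly larger than the exponent of $x$ in $m'$. $L$ is a dominant set if each of its elements is dominant in some variable. In (i), "dominant in $x_{i_j}$" refers to the set $\{d_1,\ldots,d_q\}$. Taylor symbols: writing $G=\{m_1,\ldots,m_t\}$, the Taylor resolution $\mathbb{T}_M$ of $S/M$ has as basis, in homological degree $s$, the Taylor symbols $[m_{j_1},\ldots,m_{j_s}]$ for $1\le j_1<\cdots<j_s\le t$, with multidegree $\operatorname{mdeg}[m_{j_1},\ldots,m_{j_s}]=\operatorname{lcm}(m_{j_1},\ldots,m_{j_s})$ and differential $$[m_{j_1},\ldots,m_{j_s}]\mapsto\sum_{r=1}^s(-1)^{r+1}\frac{\operatorname{lcm}(m_{j_1},\ldots,m_{j_s})}{\operatorname{lcm}(m_{j_1},\ldots,\widehat{m_{j_r}},\ldots,m_{j_s})}[m_{j_1},\ldots,\widehat{m_{j_r}},\ldots,m_{j_s}].$$ By convention, a minimal free resolution $\mathbb{F}$ of $S/M$ is one obtained from $\mathbb{T}_M$ by consecutive cancellations $0\to S[\sigma]\to S[\tau]\to 0$ of pairs of basis elements whose corresponding differential entry is invertible, until no invertible entries remain; its remaining basis elements are still called Taylor symbols and keep their multidegree $\operatorname{mdeg}$ and homological degree $\operatorname{hdeg}$. Thus the number of basis elements of $\mathbb{F}$ with homological degree $i$ and multidegree $l$ is the multigraded Betti number $b_{i,l}(S/M)$. *)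

theory Defs
  imports Complex_Main "HOL-Library.Poly_Mapping"
begin

section \<open>Monomials and polynomials\<close>

text \<open>
  The finite type \<open>'n\<close> indexes the variables, so a monomial is an exponent vector (with product
  \<open>+\<close>, quotient \<open>-\<close> and unit \<open>0\<close>), and \<open>('n, 'k) mpoly\<close>, with the convolution product, is the
  polynomial ring over \<open>'k\<close> in \<open>CARD('n)\<close> variables.
\<close>

type_synonym 'n mon = "'n \<Rightarrow>\<^sub>0 nat"
type_synonym ('n, 'k) mpoly = "'n mon \<Rightarrow>\<^sub>0 'k"

abbreviation expo :: "'n mon \<Rightarrow> 'n \<Rightarrow> nat" where
  "expo \<equiv> Poly_Mapping.lookup"

definition monom_poly :: "'n mon \<Rightarrow> ('n, 'k::field) mpoly" where
  "monom_poly m = Poly_Mapping.single m 1"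

definition mon_dvd :: "'n mon \<Rightarrow> 'n mon \<Rightarrow> bool" where
  "mon_dvd a b \<longleftrightarrow> (\<exists>c. b = a + c)"

text \<open>Meaningful for finite sets only; the \<open>0\<close> makes the lcm of the empty set the monomial \<open>1\<close>.\<close>

lift_definition mon_lcm :: "'n::finite mon set \<Rightarrow> 'n mon" is
  "\<lambda>A x. Max (insert 0 ((\<lambda>m. m x) ` A))"
  by simp

lemma expo_mon_lcm:
  "expo (mon_lcm A) x = Max (insert 0 ((\<lambda>m. expo m x) ` A))"
  by transfer simp

lemma mon_dvd_iff: "mon_dvd a b \<longleftrightarrow> (\<forall>x. expo a x \<le> expo b x)"
proof
  assume "\<forall>x. expo a x \<le> expo b x"
  then have "b = a + (b - a)"
    by (intro poly_mapping_eqI) (simp add: lookup_add lookup_minus)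
  then show "mon_dvd a b"
    unfolding mon_dvd_def by blast
qed (auto simp: mon_dvd_def lookup_add)

lemma mon_lcm_dvd_iff:
  assumes "finite A"
  shows "mon_dvd (mon_lcm A) b \<longleftrightarrow> (\<forall>m\<in>A. mon_dvd m b)"
  using assms by (auto simp: mon_dvd_iff expo_mon_lcm)


section \<open>Monomial ideals\<close>

interpretation ideal: module "times :: 'r::comm_ring_1 \<Rightarrow> 'r \<Rightarrow> 'r"
  by standard (simp_all add: algebra_simps)

definition monomial_ideal :: "('n, 'k::field) mpoly set \<Rightarrow> bool" where
  "monomial_ideal M \<longleftrightarrow> (\<exists>A. M = ideal.span (monom_poly ` A))"

definition minimal_monomial_generators :: "('n, 'k::field) mpoly set \<Rightarrow> 'n mon set \<Rightarrow> bool" where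
  "minimal_monomial_generators M G \<longleftrightarrow>
     ideal.span (monom_poly ` G) = M \<and> (\<forall>G'. G' \<subset> G \<longrightarrow> ideal.span (monom_poly ` G') \<noteq> M)"


section \<open>Dominance\<close>

definition dominant_in :: "'n mon set \<Rightarrow> 'n mon \<Rightarrow> 'n \<Rightarrow> bool" where
  "dominant_in L m x \<longleftrightarrow> m \<in> L \<and> (\<forall>m'\<in>L - {m}. expo m' x < expo m x)"

definition dominant_set :: "'n mon set \<Rightarrow> bool" where
  "dominant_set L \<longleftrightarrow> finite L \<and> (\<forall>m\<in>L. \<exists>x. dominant_in L m x)"


section \<open>The Taylor resolution and consecutive cancellations\<close>

text \<open>
  For an enumeration \<open>ms = [m\<^sub>1, \<dots>, m\<^sub>t]\<close> of the minimal generators, the Taylor symbols are the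
  sublists of \<open>ms\<close>.
\<close>

type_synonym 'n symbol = "'n mon list"

definition hdeg :: "'n symbol \<Rightarrow> nat" where
  "hdeg \<sigma> = length \<sigma>"

definition mdeg :: "'n::finite symbol \<Rightarrow> 'n mon" where
  "mdeg \<sigma> = mon_lcm (set \<sigma>)"

text \<open>
  A complex of free \<open>'r\<close>-modules with a distinguished basis of symbols, given by the matrix of its
  differential: \<open>entry F \<sigma> \<tau>\<close> is the coefficient of \<open>[\<tau>]\<close> in the image of \<open>[\<sigma>]\<close>.  Only the entries
  with \<open>\<sigma>\<close> and \<open>\<tau>\<close> in \<open>basis F\<close> are meaningful.
\<close>

datatype ('b, 'r) based_complex =
  Based_Complex (basis: "'b set") (entry: "'b \<Rightarrow> 'b \<Rightarrow> 'r")

definition drop_nth :: "nat \<Rightarrow> 'a list \<Rightarrow> 'a list" where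
  "drop_nth r xs = take r xs @ drop (Suc r) xs"

text \<open>
  Positions are counted from \<open>0\<close>, whence the sign \<open>(-1)\<^sup>r\<close>.  For distinct \<open>ms\<close> at most one \<open>r\<close>
  contributes to an entry.
\<close>

definition taylor :: "'n::finite mon list \<Rightarrow> ('n symbol, ('n, 'k::field) mpoly) based_complex" where
  "taylor ms = Based_Complex (set (subseqs ms))
     (\<lambda>\<sigma> \<tau>. \<Sum>r<length \<sigma>.
        if \<tau> = drop_nth r \<sigma> then (-1) ^ r * monom_poly (mdeg \<sigma> - mdeg (drop_nth r \<sigma>)) else 0)"

text \<open>
  Cancelling \<open>0 \<rightarrow> S[\<sigma>] \<rightarrow> S[\<tau>] \<rightarrow> 0\<close> along an invertible entry with inverse \<open>u\<close>: replace
  \<open>[\<tau>]\<close> by the image of \<open>[\<sigma>]\<close> and each other \<open>[\<rho>]\<close> by \<open>[\<rho>] - entry F \<rho> \<tau> * u * [\<sigma>]\<close>; in the new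
  basis the pair \<open>\<sigma>, \<tau>\<close> splits off, and what remains has the matrix below.
\<close>

inductive cancellation :: "('b, 'r::comm_ring_1) based_complex \<Rightarrow> ('b, 'r) based_complex \<Rightarrow> bool" where
  "cancellation F
     (Based_Complex (basis F - {\<sigma>, \<tau>}) (\<lambda>\<rho> \<pi>. entry F \<rho> \<pi> - entry F \<rho> \<tau> * u * entry F \<sigma> \<pi>))"
  if "\<sigma> \<in> basis F" "\<tau> \<in> basis F" "u * entry F \<sigma> \<tau> = 1"

definition no_invertible_entries :: "('b, 'r::comm_ring_1) based_complex \<Rightarrow> bool" where
  "no_invertible_entries F \<longleftrightarrow> (\<forall>\<sigma>\<in>basis F. \<forall>\<tau>\<in>basis F. \<not> entry F \<sigma> \<tau> dvd 1)"

text \<open>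
  Minimal free resolutions of \<open>S/M\<close> are those obtained from the Taylor resolution of an enumeration
  \<open>ms\<close> of the minimal generators of \<open>M\<close> by consecutive cancellations.
\<close>

definition minimal_free_resolution ::
    "('n::finite, 'k::field) mpoly set \<Rightarrow> ('n symbol, ('n, 'k) mpoly) based_complex \<Rightarrow> bool" where
  "minimal_free_resolution M F \<longleftrightarrow>
     (\<exists>ms. distinct ms \<and> minimal_monomial_generators M (set ms) \<and>
           cancellation\<^sup>*\<^sup>* (taylor ms) F \<and> no_invertible_entries F)"

end

theory Submission
  imports Defs "Jordan_Normal_Form.Determinant"
begin

text \<open>
  Substitute \<open>0\<close> for the variables \<open>x\<close> in \<open>Z = i ` {1..q}\<close> and \<open>1\<close> for all others.  This turns the Taylor
  resolution into a complex of vector spaces which splits according to the \<open>Z\<close>-part of the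
  multidegree, and cancellations into cancellations.  In the part where the exponents on \<open>Z\<close> equal
  \<open>\<alpha>\<close>, the symbol \<open>[d\<^sub>1, \<dots>, d\<^sub>q]\<close> is a cycle, because by dominance all its faces leave that part.
  By (ii) each generator can be mapped to some \<open>j\<close> such that it has exponent \<open>\<alpha> (i j)\<close> in \<open>i j\<close>; pulling back the
  orientation of the \<open>(q - 1)\<close>-simplex along this map gives a cocycle which is nonzero on the cycle.
  Cancellation preserves the existence of such a pair, so a symbol of homological degree \<open>q\<close> in that part
  survives.
\<close>

text \<open>As a simp rule this reassociates products to the left, which loops with \<open>mult.assoc\<close>.\<close>
declare ideal.scale_scale [simp del]

section \<open>Cancellations and pairings of cycles with cocycles\<close>

text \<open>
  Here \<open>z\<close> and \<open>\<phi>\<close> may also be a row and a column of the differential itself, which yields that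
  cancellation preserves \<open>d \<circ> d = 0\<close>, cycles and cocycles.
\<close>

lemma cancellation_pairing:
  fixes e :: "'b \<Rightarrow> 'b \<Rightarrow> 'r::comm_ring_1"
  assumes B: "finite B" "\<sigma> \<in> B" "\<tau> \<in> B"
    and u: "u * e \<sigma> \<tau> = 1"
    and diag: "e \<sigma> \<sigma> = 0" "e \<tau> \<tau> = 0"
    and sq: "(\<Sum>\<rho>\<in>B. e \<sigma> \<rho> * e \<rho> \<tau>) = 0"
    and z: "(\<Sum>\<rho>\<in>B. z \<rho> * e \<rho> \<tau>) = 0"
    and \<phi>: "(\<Sum>\<rho>\<in>B. e \<sigma> \<rho> * \<phi> \<rho>) = 0"
  shows "(\<Sum>\<rho>\<in>B - {\<sigma>, \<tau>}. (z \<rho> - z \<tau> * u * e \<sigma> \<rho>) * (\<phi> \<rho> - e \<rho> \<tau> * u * \<phi> \<sigma>))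
           = (\<Sum>\<rho>\<in>B. z \<rho> * \<phi> \<rho>)"
proof -
  have ne: "\<sigma> \<noteq> \<tau>"
    using u diag by auto
  let ?C = "B - {\<sigma>, \<tau>}"
  have split: "(\<Sum>\<rho>\<in>B. g \<rho>) = g \<sigma> + g \<tau> + (\<Sum>\<rho>\<in>?C. g \<rho>)" for g :: "'b \<Rightarrow> 'r"
  proof -
    have "B = insert \<sigma> (insert \<tau> ?C)"
      using B by auto
    moreover have "sum g (insert \<sigma> (insert \<tau> ?C)) = g \<sigma> + g \<tau> + sum g ?C"
      using B(1) ne by (simp add: add.assoc)
    ultimately show ?thesis by simp
  qed
  \<comment> \<open>The terms at \<open>\<sigma>\<close> and \<open>\<tau>\<close> are split off;
    because the diagonal entries vanish, at most one of them remains in each relation.\<close>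
  have sq': "(\<Sum>\<rho>\<in>?C. e \<sigma> \<rho> * e \<rho> \<tau>) = 0"
    using sq diag by (simp add: split)
  have z': "(\<Sum>\<rho>\<in>?C. z \<rho> * e \<rho> \<tau>) = - (z \<sigma> * e \<sigma> \<tau>)"
    using z diag by (simp add: split eq_neg_iff_add_eq_0 add.commute)
  have \<phi>': "(\<Sum>\<rho>\<in>?C. e \<sigma> \<rho> * \<phi> \<rho>) = - (e \<sigma> \<tau> * \<phi> \<tau>)"
    using \<phi> diag by (simp add: split eq_neg_iff_add_eq_0 add.commute)
  have expand: "(a - b * u * c) * (f - g * u * k) =
      a * f - b * u * (c * f) - u * k * (a * g) + b * u * u * k * (c * g)" for a b c f g k
    by (simp add: left_diff_distrib right_diff_distrib mult_ac)
  have "(\<Sum>\<rho>\<in>?C. (z \<rho> - z \<tau> * u * e \<sigma> \<rho>) * (\<phi> \<rho> - e \<rho> \<tau> * u * \<phi> \<sigma>))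
      = (\<Sum>\<rho>\<in>?C. z \<rho> * \<phi> \<rho> - z \<tau> * u * (e \<sigma> \<rho> * \<phi> \<rho>) - u * \<phi> \<sigma> * (z \<rho> * e \<rho> \<tau>)
          + z \<tau> * u * u * \<phi> \<sigma> * (e \<sigma> \<rho> * e \<rho> \<tau>))"
    by (rule sum.cong[OF refl]) (rule expand)
  also have "\<dots> = (\<Sum>\<rho>\<in>?C. z \<rho> * \<phi> \<rho>) - z \<tau> * u * (\<Sum>\<rho>\<in>?C. e \<sigma> \<rho> * \<phi> \<rho>)
      - u * \<phi> \<sigma> * (\<Sum>\<rho>\<in>?C. z \<rho> * e \<rho> \<tau>)
      + z \<tau> * u * u * \<phi> \<sigma> * (\<Sum>\<rho>\<in>?C. e \<sigma> \<rho> * e \<rho> \<tau>)"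
    by (simp add: sum.distrib sum_subtractf sum_distrib_left)
  \<comment> \<open>Since \<open>u\<close> inverts the pivot entry, the correction sums give back
    exactly the terms of the pairing at the two cancelled symbols.\<close>
  also have "\<dots> = (\<Sum>\<rho>\<in>?C. z \<rho> * \<phi> \<rho>) + (u * e \<sigma> \<tau>) * (z \<tau> * \<phi> \<tau>) + (u * e \<sigma> \<tau>) * (z \<sigma> * \<phi> \<sigma>)"
    unfolding sq' z' \<phi>' by (simp add: algebra_simps)
  also have "\<dots> = (\<Sum>\<rho>\<in>B. z \<rho> * \<phi> \<rho>)"
    unfolding u split[of "\<lambda>\<rho>. z \<rho> * \<phi> \<rho>"] by (simp only: mult_1_left add_ac)
  finally show ?thesis .
qed

text \<open>\<open>h\<close> stands for the homological degree and \<open>P\<close> for a union of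
  multidegree parts. No nonzero entry joins \<open>P\<close> to its complement, so the complex is a
  direct sum; the last clause is \<open>d \<circ> d = 0\<close>.\<close>

definition graded_complex :: "('b \<Rightarrow> nat) \<Rightarrow> ('b \<Rightarrow> bool) \<Rightarrow> ('b, 'r::comm_ring_1) based_complex \<Rightarrow> bool"
  where "graded_complex h P F \<longleftrightarrow> finite (basis F) \<and>
    (\<forall>\<sigma>\<in>basis F. \<forall>\<tau>\<in>basis F. entry F \<sigma> \<tau> \<noteq> 0 \<longrightarrow> h \<sigma> = Suc (h \<tau>) \<and> P \<sigma> = P \<tau>) \<and>
    (\<forall>\<rho>\<in>basis F. \<forall>\<pi>\<in>basis F. (\<Sum>\<sigma>\<in>basis F. entry F \<rho> \<sigma> * entry F \<sigma> \<pi>) = 0)"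

text \<open>A certificate that the cycle \<open>z\<close> is no boundary. It consists of explicit
  functions, so it can be carried through a cancellation by formulas.\<close>

definition cycle_cocycle_pair ::
  "('b \<Rightarrow> nat) \<Rightarrow> ('b \<Rightarrow> bool) \<Rightarrow> nat \<Rightarrow> ('b, 'r::comm_ring_1) based_complex \<Rightarrow> ('b \<Rightarrow> 'r) \<Rightarrow> ('b \<Rightarrow> 'r) \<Rightarrow> bool"
  where "cycle_cocycle_pair h P q F z \<phi> \<longleftrightarrow>
    (\<forall>\<sigma>\<in>basis F. z \<sigma> \<noteq> 0 \<longrightarrow> h \<sigma> = q \<and> P \<sigma>) \<and>
    (\<forall>\<pi>\<in>basis F. (\<Sum>\<sigma>\<in>basis F. z \<sigma> * entry F \<sigma> \<pi>) = 0) \<and>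
    (\<forall>\<rho>\<in>basis F. (\<Sum>\<sigma>\<in>basis F. entry F \<rho> \<sigma> * \<phi> \<sigma>) = 0) \<and>
    (\<Sum>\<sigma>\<in>basis F. z \<sigma> * \<phi> \<sigma>) \<noteq> 0"

text \<open>The chain is changed by a multiple of the image of \<open>[\<sigma>]\<close> so as to
  vanish at \<open>\<tau>\<close>, and the cochain is corrected dually. The one pairing identity
  evaluates all four sums involved.\<close>

lemma cancellation_preserves_cycle_cocycle_pair:
  fixes F :: "('b, 'r::comm_ring_1) based_complex"
  assumes "cancellation F F'" "graded_complex h P F" "cycle_cocycle_pair h P q F z \<phi>"
  shows "graded_complex h P F' \<and> (\<exists>z' \<phi>'. cycle_cocycle_pair h P q F' z' \<phi>')"
  using assms(1)
proof cases
  case (1 \<sigma> \<tau> u)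
  note F' = 1(1) and \<sigma> = 1(2) and \<tau> = 1(3) and u = 1(4)
  let ?e = "entry F"
  have fin: "finite (basis F)"
    and gr: "\<And>\<sigma> \<tau>. \<sigma> \<in> basis F \<Longrightarrow> \<tau> \<in> basis F \<Longrightarrow> ?e \<sigma> \<tau> \<noteq> 0 \<Longrightarrow> h \<sigma> = Suc (h \<tau>) \<and> P \<sigma> = P \<tau>"
    and sq: "\<And>\<rho> \<pi>. \<rho> \<in> basis F \<Longrightarrow> \<pi> \<in> basis F \<Longrightarrow> (\<Sum>\<sigma>\<in>basis F. ?e \<rho> \<sigma> * ?e \<sigma> \<pi>) = 0"
    using assms(2) unfolding graded_complex_def by blast+
  have supp: "\<And>\<sigma>. \<sigma> \<in> basis F \<Longrightarrow> z \<sigma> \<noteq> 0 \<Longrightarrow> h \<sigma> = q \<and> P \<sigma>"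
    and cyc: "\<And>\<pi>. \<pi> \<in> basis F \<Longrightarrow> (\<Sum>\<sigma>\<in>basis F. z \<sigma> * ?e \<sigma> \<pi>) = 0"
    and cocyc: "\<And>\<rho>. \<rho> \<in> basis F \<Longrightarrow> (\<Sum>\<sigma>\<in>basis F. ?e \<rho> \<sigma> * \<phi> \<sigma>) = 0"
    and pair: "(\<Sum>\<sigma>\<in>basis F. z \<sigma> * \<phi> \<sigma>) \<noteq> 0"
    using assms(3) unfolding cycle_cocycle_pair_def by blast+
  have diag: "?e \<rho> \<rho> = 0" if "\<rho> \<in> basis F" for \<rho>
    using gr[of \<rho> \<rho>] that by fastforce
  have st: "h \<sigma> = Suc (h \<tau>) \<and> P \<sigma> = P \<tau>"
    using gr[OF \<sigma> \<tau>] u by fastforce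
  note pairing = cancellation_pairing[OF fin \<sigma> \<tau> u diag[OF \<sigma>] diag[OF \<tau>] sq[OF \<sigma> \<tau>]]
  let ?z = "\<lambda>\<rho>. z \<rho> - z \<tau> * u * ?e \<sigma> \<rho>"
  let ?\<phi> = "\<lambda>\<rho>. \<phi> \<rho> - ?e \<rho> \<tau> * u * \<phi> \<sigma>"
  have "graded_complex h P F'"
    unfolding graded_complex_def F' based_complex.sel
  proof (intro conjI ballI impI)
    show "finite (basis F - {\<sigma>, \<tau>})"
      using fin by simp
  next
    fix \<rho> \<pi> assume *: "\<rho> \<in> basis F - {\<sigma>, \<tau>}" "\<pi> \<in> basis F - {\<sigma>, \<tau>}"
      and "?e \<rho> \<pi> - ?e \<rho> \<tau> * u * ?e \<sigma> \<pi> \<noteq> 0"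
    \<comment> \<open>A correction comes from a zigzag \<open>\<rho> \<rightarrow> \<tau>
      \<leftarrow> \<sigma> \<rightarrow> \<pi>\<close>, which also drops the degree by one and
      stays within a part.\<close>
    then have "?e \<rho> \<pi> \<noteq> 0 \<or> ?e \<rho> \<tau> \<noteq> 0 \<and> ?e \<sigma> \<pi> \<noteq> 0"
      by auto
    then have "h \<rho> = Suc (h \<pi>) \<and> P \<rho> = P \<pi>"
      using gr[of \<rho> \<pi>] gr[of \<rho> \<tau>] gr[of \<sigma> \<pi>] st \<sigma> \<tau> * by auto
    then show "h \<rho> = Suc (h \<pi>)" "P \<rho> = P \<pi>" by auto
  next
    fix \<rho> \<pi> assume "\<rho> \<in> basis F - {\<sigma>, \<tau>}" "\<pi> \<in> basis F - {\<sigma>, \<tau>}"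
    then show "(\<Sum>\<kappa>\<in>basis F - {\<sigma>, \<tau>}. (?e \<rho> \<kappa> - ?e \<rho> \<tau> * u * ?e \<sigma> \<kappa>) * (?e \<kappa> \<pi> - ?e \<kappa> \<tau> * u * ?e \<sigma> \<pi>)) = 0"
      using pairing[of "?e \<rho>" "\<lambda>\<kappa>. ?e \<kappa> \<pi>"] sq \<sigma> \<tau> by simp
  qed
  moreover have "cycle_cocycle_pair h P q F' ?z ?\<phi>"
    unfolding cycle_cocycle_pair_def F' based_complex.sel
  proof (intro conjI ballI impI)
    fix \<rho> assume *: "\<rho> \<in> basis F - {\<sigma>, \<tau>}" and "?z \<rho> \<noteq> 0"
    then have "z \<rho> \<noteq> 0 \<or> z \<tau> \<noteq> 0 \<and> ?e \<sigma> \<rho> \<noteq> 0"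
      by auto
    then have "h \<rho> = q \<and> P \<rho>"
      using supp[of \<rho>] supp[of \<tau>] gr[of \<sigma> \<rho>] st \<sigma> \<tau> * by auto
    then show "h \<rho> = q" "P \<rho>" by auto
  next
    fix \<pi> assume "\<pi> \<in> basis F - {\<sigma>, \<tau>}"
    then show "(\<Sum>\<kappa>\<in>basis F - {\<sigma>, \<tau>}. ?z \<kappa> * (?e \<kappa> \<pi> - ?e \<kappa> \<tau> * u * ?e \<sigma> \<pi>)) = 0"
      using pairing[of z "\<lambda>\<kappa>. ?e \<kappa> \<pi>"] sq cyc \<sigma> \<tau> by simp
  next
    fix \<rho> assume "\<rho> \<in> basis F - {\<sigma>, \<tau>}"
    then show "(\<Sum>\<kappa>\<in>basis F - {\<sigma>, \<tau>}. (?e \<rho> \<kappa> - ?e \<rho> \<tau> * u * ?e \<sigma> \<kappa>) * ?\<phi> \<kappa>) = 0"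
      using pairing[of "?e \<rho>" \<phi>] sq cocyc \<sigma> \<tau> by simp
  next
    show "(\<Sum>\<kappa>\<in>basis F - {\<sigma>, \<tau>}. ?z \<kappa> * ?\<phi> \<kappa>) \<noteq> 0"
      using pairing[of z \<phi>] cyc cocyc pair \<sigma> \<tau> by simp
  qed
  ultimately show ?thesis by blast
qed

text \<open>A nonzero pairing has a nonzero term, and its symbol lies in the support of the
  cycle.\<close>

lemma cancellations_keep_basis_element:
  fixes F :: "('b, 'r::comm_ring_1) based_complex"
  assumes "cancellation\<^sup>*\<^sup>* F F'" "graded_complex h P F" "cycle_cocycle_pair h P q F z \<phi>"
  shows "\<exists>\<sigma>\<in>basis F'. h \<sigma> = q \<and> P \<sigma>"
proof -
  have "graded_complex h P F' \<and> (\<exists>z \<phi>. cycle_cocycle_pair h P q F' z \<phi>)"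
    using assms(1)
  proof induction
    case base
    then show ?case using assms(2,3) by blast
  next
    case (step F' F'')
    then show ?case using cancellation_preserves_cycle_cocycle_pair by blast
  qed
  then obtain z \<phi> where c: "cycle_cocycle_pair h P q F' z \<phi>"
    by blast
  then have "(\<Sum>\<sigma>\<in>basis F'. z \<sigma> * \<phi> \<sigma>) \<noteq> 0"
    by (simp add: cycle_cocycle_pair_def)
  then obtain \<sigma> where "\<sigma> \<in> basis F'" "z \<sigma> * \<phi> \<sigma> \<noteq> 0"
    by (meson sum.neutral)
  moreover from this have "z \<sigma> \<noteq> 0"
    by auto
  ultimately show ?thesis
    using c by (auto simp: cycle_cocycle_pair_def)
qed

text \<open>A ring homomorphism keeps the pivot invertible, with inverse \<open>\<psi> u\<close>,
  and commutes with the formula for the new entries. \<open>map_based_complex\<close> acts on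
  coefficients only and leaves the basis alone.\<close>

lemma cancellations_map:
  fixes \<psi> :: "'r::comm_ring_1 \<Rightarrow> 's::comm_ring_1"
  assumes "\<psi> 1 = 1" "\<And>a b. \<psi> (a - b) = \<psi> a - \<psi> b" "\<And>a b. \<psi> (a * b) = \<psi> a * \<psi> b"
    and "cancellation\<^sup>*\<^sup>* F F'"
  shows "cancellation\<^sup>*\<^sup>* (map_based_complex \<psi> F) (map_based_complex \<psi> F')"
  using assms(4)
proof induction
  case (step F' F'')
  from step(2) have "cancellation (map_based_complex \<psi> F') (map_based_complex \<psi> F'')"
  proof cases
    case (1 \<sigma> \<tau> u)
    have "\<psi> u * \<psi> (entry F' \<sigma> \<tau>) = 1"
      using 1(4) assms(1,3) by metis
    then have "cancellation (map_based_complex \<psi> F')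
       (Based_Complex (basis (map_based_complex \<psi> F') - {\<sigma>, \<tau>})
         (\<lambda>\<rho> \<pi>. entry (map_based_complex \<psi> F') \<rho> \<pi> -
            entry (map_based_complex \<psi> F') \<rho> \<tau> * \<psi> u * entry (map_based_complex \<psi> F') \<sigma> \<pi>))"
      using 1 by (intro cancellation.intros) (simp_all add: based_complex.map_sel)
    then show ?thesis
      unfolding 1(1) by (simp add: based_complex.map_sel assms(2,3) comp_def)
  qed
  with step(3) show ?case by simp
qed simp

section \<open>Deleting list entries\<close>

lemma length_drop_nth: "r < length xs \<Longrightarrow> length (drop_nth r xs) = length xs - 1"
  by (auto simp: drop_nth_def)

lemma nth_drop_nth:
  "r < length xs \<Longrightarrow> s < length xs - 1 \<Longrightarrow> drop_nth r xs ! s = xs ! (if s < r then s else Suc s)"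
  by (auto simp: drop_nth_def nth_append)

lemma set_drop_nth_subset: "set (drop_nth r xs) \<subseteq> set xs"
  by (auto simp: drop_nth_def dest: in_set_takeD in_set_dropD)

lemma drop_nth_in_subseqs:
  assumes "xs \<in> set (subseqs ys)"
  shows "drop_nth r xs \<in> set (subseqs ys)"
proof -
  have "drop_nth r xs \<in> set (subseqs xs)" for xs :: "'a list"
  proof (induction xs arbitrary: r)
    case (Cons x xs)
    then show ?case
      by (cases r) (auto simp: drop_nth_def Let_def subseqs_refl)
  qed (simp add: drop_nth_def)
  moreover have "as \<in> set (subseqs ys)" if "as \<in> set (subseqs bs)" "bs \<in> set (subseqs ys)" for as bs ys :: "'a list"
    using that
  proof (induction ys arbitrary: as bs)
    case (Cons y ys)
    then show ?case by (fastforce simp: Let_def)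
  qed simp
  ultimately show ?thesis
    using assms by blast
qed

text \<open>The simplicial face identity; the shift to \<open>r - 1\<close> accounts for the entry
  already deleted.\<close>

lemma drop_nth_drop_nth:
  assumes "s < r" "r < length xs"
  shows "drop_nth s (drop_nth r xs) = drop_nth (r - 1) (drop_nth s xs)"
  using assms by (intro nth_equalityI) (auto simp: length_drop_nth nth_drop_nth)

text \<open>Index pairs with \<open>s < r\<close> are matched with those with
  \<open>r \<le> s\<close> by \<open>(r, s) \<mapsto> (s, r - 1)\<close>, as for the square of the
  simplicial boundary.\<close>

lemma alternating_double_sum_eq_0:
  fixes g :: "nat \<Rightarrow> nat \<Rightarrow> 'a::ab_group_add"
  assumes "\<And>r s. s < r \<Longrightarrow> r < Suc N \<Longrightarrow> g r s = - g s (r - 1)"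
  shows "(\<Sum>r<Suc N. \<Sum>s<N. g r s) = 0"
proof -
  let ?S = "{..<Suc N} \<times> {..<N}"
  let ?A = "{(r, s) \<in> ?S. s < r}" and ?B = "{(r, s) \<in> ?S. r \<le> s}"
  have "finite ?S" by simp
  then have fin: "finite ?A" "finite ?B"
    by (auto intro: finite_subset[of _ ?S])
  have "(\<Sum>r<Suc N. \<Sum>s<N. g r s) = (\<Sum>(r, s)\<in>?S. g r s)"
    by (rule sum.cartesian_product)
  also have "?S = ?A \<union> ?B" by auto
  also have "(\<Sum>(r, s)\<in>?A \<union> ?B. g r s) = (\<Sum>(r, s)\<in>?A. g r s) + (\<Sum>(r, s)\<in>?B. g r s)"
    by (rule sum.union_disjoint) (use fin in auto)
  also have "(\<Sum>(r, s)\<in>?A. g r s) = (\<Sum>(r, s)\<in>?B. - g r s)"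
    by (rule sum.reindex_bij_witness[where i = "\<lambda>(r, s). (Suc s, r)" and j = "\<lambda>(r, s). (s, r - 1)"])
      (auto simp: assms)
  also have "\<dots> + (\<Sum>(r, s)\<in>?B. g r s) = 0"
    by (simp add: sum.distrib[symmetric] case_prod_unfold)
  finally show ?thesis .
qed

section \<open>Specialising variables\<close>

text \<open>Substitutes \<open>0\<close> for the variables in \<open>Z\<close> and \<open>1\<close> for all others.\<close>

definition specialize :: "'n set \<Rightarrow> ('n, 'k::field) mpoly \<Rightarrow> 'k" where
  "specialize Z p = (\<Sum>m\<in>Poly_Mapping.keys p. if \<forall>x\<in>Z. expo m x = 0 then Poly_Mapping.lookup p m else 0)"

lemma specialize_add: "specialize Z (p + q) = specialize Z p + specialize Z q"
  unfolding specialize_def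
  by (rule setsum_keys_plus_distrib[where f = "\<lambda>m c. if \<forall>x\<in>Z. expo m x = 0 then c else 0"]) auto

lemma specialize_single: "specialize Z (Poly_Mapping.single m c) = (if \<forall>x\<in>Z. expo m x = 0 then c else 0)"
  by (simp add: specialize_def)

lemma specialize_0: "specialize Z 0 = 0"
  by (simp add: specialize_def)

lemma specialize_1: "specialize Z 1 = 1"
  by (simp add: specialize_single flip: single_one)

lemma specialize_diff: "specialize Z (p - q) = specialize Z p - specialize Z q"
  by (metis add_diff_cancel_right' diff_add_cancel specialize_add)

lemma specialize_minus: "specialize Z (- p) = - specialize Z p"
  using specialize_diff[of Z 0 p] by (simp add: specialize_0)

lemma update_eq_single_add:
  "a \<notin> Poly_Mapping.keys f \<Longrightarrow> Poly_Mapping.update a b f = Poly_Mapping.single a b + f"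
  by (intro poly_mapping_eqI)
    (auto simp: lookup_add lookup_single update.rep_eq when_def in_keys_iff)

text \<open>Both factors are built up term by term; for single terms, a sum of exponents vanishes on
  \<open>Z\<close> iff both summands do.\<close>

lemma specialize_mult: "specialize Z (p * q) = specialize Z p * specialize Z q"
proof (induction p rule: update_induct)
  case (update p a b)
  have "specialize Z (Poly_Mapping.single a b * q) = specialize Z (Poly_Mapping.single a b) * specialize Z q"
  proof (induction q rule: update_induct)
    case (update q c d)
    then show ?case
      by (auto simp: update_eq_single_add distrib_left specialize_add mult_single specialize_single lookup_add)
  qed (simp add: specialize_0)
  with update show ?case
    by (simp add: update_eq_single_add distrib_right specialize_add)
qed (simp add: specialize_0)

lemma specialize_sum: "specialize Z (\<Sum>a\<in>A. f a) = (\<Sum>a\<in>A. specialize Z (f a))"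
  by (induction A rule: infinite_finite_induct) (simp_all add: specialize_0 specialize_add)

lemma specialize_neg_one_power: "specialize Z ((- 1) ^ r) = (- 1) ^ r"
  by (induction r) (simp_all add: specialize_1 specialize_mult specialize_minus)

section \<open>The specialised Taylor complex\<close>

lemma expo_mdeg_mono:
  assumes "set \<tau> \<subseteq> set \<sigma>"
  shows "expo (mdeg \<tau>) x \<le> expo (mdeg \<sigma>) x"
  unfolding mdeg_def expo_mon_lcm using assms by (intro Max_mono) auto

lemma expo_le_mdeg: "m \<in> set \<sigma> \<Longrightarrow> expo m x \<le> expo (mdeg \<sigma>) x"
  by (simp add: mdeg_def expo_mon_lcm)

lemma expo_mdeg_le: "(\<And>m. m \<in> set \<sigma> \<Longrightarrow> expo m x \<le> c) \<Longrightarrow> expo (mdeg \<sigma>) x \<le> c"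
  by (auto simp: mdeg_def expo_mon_lcm)

definition same_mdeg_on :: "'n set \<Rightarrow> 'n::finite symbol \<Rightarrow> 'n symbol \<Rightarrow> bool" where
  "same_mdeg_on Z \<sigma> \<tau> \<longleftrightarrow> (\<forall>x\<in>Z. expo (mdeg \<sigma>) x = expo (mdeg \<tau>) x)"

abbreviation specialized_taylor :: "'n set \<Rightarrow> 'n::finite mon list \<Rightarrow> ('n symbol, 'k::field) based_complex" where
  "specialized_taylor Z ms \<equiv> map_based_complex (specialize Z) (taylor ms)"

lemma basis_specialized_taylor: "basis (specialized_taylor Z ms) = set (subseqs ms)"
  by (simp add: based_complex.map_sel taylor_def)

text \<open>The quotient of the two multidegrees specialises to 1 if it involves no variable of
  \<open>Z\<close>, and to 0 otherwise.\<close>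

lemma entry_specialized_taylor:
  "entry (specialized_taylor Z ms :: ('n::finite symbol, 'k::field) based_complex) \<sigma> \<tau>
     = (\<Sum>r<length \<sigma>. if \<tau> = drop_nth r \<sigma> then (- 1) ^ r * of_bool (same_mdeg_on Z \<sigma> \<tau>) else 0)"
proof -
  \<comment> \<open>Subtraction is truncated, so a zero difference means equality only because the
    face has the smaller multidegree.\<close>
  have "(\<forall>x\<in>Z. expo (mdeg \<sigma> - mdeg (drop_nth r \<sigma>)) x = 0) \<longleftrightarrow> same_mdeg_on Z \<sigma> (drop_nth r \<sigma>)" for r
    using expo_mdeg_mono[OF set_drop_nth_subset[of r \<sigma>]]
    by (auto simp: same_mdeg_on_def lookup_minus le_antisym)
  then show ?thesis
    by (auto simp: based_complex.map_sel taylor_def specialize_sum specialize_mult specialize_neg_one_power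
        specialize_single specialize_0 monom_poly_def of_bool_def if_distrib intro!: sum.cong)
qed

lemma entry_specialized_taylor_nonzero:
  assumes "entry (specialized_taylor Z ms :: ('n::finite symbol, 'k::field) based_complex) \<sigma> \<tau> \<noteq> 0"
  obtains r where "r < length \<sigma>" "\<tau> = drop_nth r \<sigma>" "same_mdeg_on Z \<sigma> \<tau>"
proof -
  from assms obtain r where "r < length \<sigma>"
    "(if \<tau> = drop_nth r \<sigma> then (- 1) ^ r * of_bool (same_mdeg_on Z \<sigma> \<tau>) else (0::'k)) \<noteq> 0"
    unfolding entry_specialized_taylor by (auto elim: sum.not_neutral_contains_not_neutral)
  then show ?thesis
    by (intro that[of r]) (auto split: if_splits)
qed

text \<open>Exchanging the sums leaves one term per position, since every face of a sublist is again
  in the basis.\<close>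

lemma specialized_taylor_coboundary:
  fixes \<phi> :: "'n::finite symbol \<Rightarrow> 'k::field"
  assumes "\<rho> \<in> set (subseqs ms)"
  shows "(\<Sum>\<sigma>\<in>set (subseqs ms). entry (specialized_taylor Z ms) \<rho> \<sigma> * \<phi> \<sigma>)
     = (\<Sum>r<length \<rho>. (- 1) ^ r * of_bool (same_mdeg_on Z \<rho> (drop_nth r \<rho>)) * \<phi> (drop_nth r \<rho>))"
proof -
  have "(\<Sum>\<sigma>\<in>set (subseqs ms). entry (specialized_taylor Z ms) \<rho> \<sigma> * \<phi> \<sigma>)
     = (\<Sum>\<sigma>\<in>set (subseqs ms). \<Sum>r<length \<rho>. if \<sigma> = drop_nth r \<rho>
          then (- 1) ^ r * of_bool (same_mdeg_on Z \<rho> (drop_nth r \<rho>)) * \<phi> (drop_nth r \<rho>) else 0)"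
    by (auto simp: entry_specialized_taylor sum_distrib_right if_distrib intro!: sum.cong)
  also have "\<dots> = (\<Sum>r<length \<rho>. (- 1) ^ r * of_bool (same_mdeg_on Z \<rho> (drop_nth r \<rho>)) * \<phi> (drop_nth r \<rho>))"
    by (subst sum.swap) (auto simp: drop_nth_in_subseqs[OF assms] intro!: sum.cong)
  finally show ?thesis .
qed

text \<open>Deletions can only lower exponents, so equality at the two ends forces equality in the
  middle.\<close>

lemma same_mdeg_on_drop_nth_twice:
  "same_mdeg_on Z \<rho> (drop_nth r \<rho>) \<and> same_mdeg_on Z (drop_nth r \<rho>) (drop_nth s (drop_nth r \<rho>))
     \<longleftrightarrow> same_mdeg_on Z \<rho> (drop_nth s (drop_nth r \<rho>))"
  using expo_mdeg_mono[OF set_drop_nth_subset[of r \<rho>]]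
    expo_mdeg_mono[OF set_drop_nth_subset[of s "drop_nth r \<rho>"]]
  unfolding same_mdeg_on_def by (metis le_antisym)

text \<open>The two indicator factors merge into one depending only on the final face, hence on
  neither order of deletion; the signs then cancel as for a simplex.\<close>

lemma specialized_taylor_square_zero:
  fixes ms :: "'n::finite mon list" and Z :: "'n set"
  defines "e \<equiv> entry (specialized_taylor Z ms :: ('n symbol, 'k::field) based_complex)"
  assumes "\<rho> \<in> set (subseqs ms)"
  shows "(\<Sum>\<sigma>\<in>set (subseqs ms). e \<rho> \<sigma> * e \<sigma> \<pi>) = 0"
proof (cases "length \<rho>")
  case 0
  then show ?thesis
    by (simp add: e_def entry_specialized_taylor)
next
  case (Suc N)
  let ?g = "\<lambda>r s. if \<pi> = drop_nth s (drop_nth r \<rho>)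
              then (- 1) ^ (r + s) * of_bool (same_mdeg_on Z \<rho> (drop_nth s (drop_nth r \<rho>))) else (0::'k)"
  have "(\<Sum>\<sigma>\<in>set (subseqs ms). e \<rho> \<sigma> * e \<sigma> \<pi>)
      = (\<Sum>r<Suc N. (- 1) ^ r * of_bool (same_mdeg_on Z \<rho> (drop_nth r \<rho>)) * e (drop_nth r \<rho>) \<pi>)"
    unfolding e_def specialized_taylor_coboundary[OF assms(2)] Suc ..
  also have "\<dots> = (\<Sum>r<Suc N. \<Sum>s<N. ?g r s)"
  proof (rule sum.cong[OF refl])
    fix r assume r: "r \<in> {..<Suc N}"
    then have "e (drop_nth r \<rho>) \<pi> = (\<Sum>s<N. if \<pi> = drop_nth s (drop_nth r \<rho>)
        then (- 1) ^ s * of_bool (same_mdeg_on Z (drop_nth r \<rho>) \<pi>) else 0)"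
      using Suc by (simp add: e_def entry_specialized_taylor length_drop_nth)
    then show "(- 1) ^ r * of_bool (same_mdeg_on Z \<rho> (drop_nth r \<rho>)) * e (drop_nth r \<rho>) \<pi> = (\<Sum>s<N. ?g r s)"
      by (simp only: sum_distrib_left, intro sum.cong refl)
        (use same_mdeg_on_drop_nth_twice[of Z \<rho> r] in \<open>auto simp: power_add\<close>)
  qed
  also have "\<dots> = 0"
  proof (rule alternating_double_sum_eq_0)
    fix r s assume sr: "s < r" "r < Suc N"
    then have "drop_nth s (drop_nth r \<rho>) = drop_nth (r - 1) (drop_nth s \<rho>)"
      using Suc by (intro drop_nth_drop_nth) auto
    moreover have "(- 1) ^ (r + s) = - ((- 1) ^ (s + (r - 1)) :: 'k)"
      using sr by (cases r) (auto simp: power_add)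
    ultimately show "?g r s = - ?g s (r - 1)"
      by simp
  qed
  finally show ?thesis .
qed

lemma graded_complex_specialized_taylor:
  assumes "\<And>\<sigma> \<tau>. \<sigma> \<in> set (subseqs ms) \<Longrightarrow> \<tau> \<in> set (subseqs ms) \<Longrightarrow> same_mdeg_on Z \<sigma> \<tau> \<Longrightarrow> P \<sigma> = P \<tau>"
  shows "graded_complex hdeg P (specialized_taylor Z ms :: ('n::finite symbol, 'k::field) based_complex)"
  unfolding graded_complex_def basis_specialized_taylor
proof (intro conjI ballI impI)
  fix \<sigma> \<tau> assume "\<sigma> \<in> set (subseqs ms)" "\<tau> \<in> set (subseqs ms)"
    and "entry (specialized_taylor Z ms :: ('n symbol, 'k) based_complex) \<sigma> \<tau> \<noteq> 0"
  then show "hdeg \<sigma> = Suc (hdeg \<tau>)" "P \<sigma> = P \<tau>"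
    using assms by (auto elim!: entry_specialized_taylor_nonzero simp: hdeg_def length_drop_nth)
qed (simp_all add: specialized_taylor_square_zero)

section \<open>The orientation cochain\<close>

text \<open>The pullback along \<open>f\<close> of the orientation of the simplex with vertices \<open>0, \<dots>, q - 1\<close>.\<close>

definition orientation_cochain :: "nat \<Rightarrow> ('a \<Rightarrow> nat) \<Rightarrow> 'a list \<Rightarrow> 'k::field" where
  "orientation_cochain q f \<sigma> =
     (if length \<sigma> = q then det (mat q q (\<lambda>(r, c). of_bool (f (\<sigma> ! r) = c))) else 0)"

text \<open>Row \<open>r\<close> of the matrix reads off coordinate \<open>f (\<sigma> ! r)\<close>
  of a vector, or gives \<open>0\<close> if that index is at least \<open>q\<close>. The kernel thus
  consists of the vectors vanishing at all values of \<open>f\<close> on \<open>\<sigma>\<close>,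
  and is nonzero iff some value below \<open>q\<close> is missed.\<close>

lemma orientation_cochain_eq_0_iff:
  assumes "length \<sigma> = q"
  shows "orientation_cochain q f \<sigma> = (0::'k::field) \<longleftrightarrow> \<not> {..<q} \<subseteq> f ` set \<sigma>"
proof -
  let ?A = "mat q q (\<lambda>(r, c). of_bool (f (\<sigma> ! r) = c)) :: 'k mat"
  have row: "(?A *\<^sub>v v) $ r = (if f (\<sigma> ! r) < q then v $ (f (\<sigma> ! r)) else 0)"
    if "v \<in> carrier_vec q" "r < q" for v r
    using that by (auto simp: scalar_prod_def of_bool_def if_distrib[of "\<lambda>x. x * _"] cong: if_cong)
  have "orientation_cochain q f \<sigma> = (0::'k) \<longleftrightarrow> (\<exists>v. v \<in> carrier_vec q \<and> v \<noteq> 0\<^sub>v q \<and> ?A *\<^sub>v v = 0\<^sub>v q)"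
    using assms by (simp add: orientation_cochain_def det_0_iff_vec_prod_zero_field[of _ q])
  also have "\<dots> \<longleftrightarrow> \<not> {..<q} \<subseteq> f ` set \<sigma>"
  proof
    assume "\<exists>v. v \<in> carrier_vec q \<and> v \<noteq> 0\<^sub>v q \<and> ?A *\<^sub>v v = 0\<^sub>v q"
    then obtain v where v: "v \<in> carrier_vec q" "v \<noteq> 0\<^sub>v q" "?A *\<^sub>v v = 0\<^sub>v q"
      by blast
    then obtain c where c: "c < q" "v $ c \<noteq> 0"
      by (metis carrier_vecD eq_vecI index_zero_vec)
    have "f (\<sigma> ! r) \<noteq> c" if "r < q" for r
      using row[OF v(1) that] v(3) c that by auto
    then show "\<not> {..<q} \<subseteq> f ` set \<sigma>"
      using c assms by (force simp: in_set_conv_nth)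
  next
    assume "\<not> {..<q} \<subseteq> f ` set \<sigma>"
    then obtain c where c: "c < q" "c \<notin> f ` set \<sigma>"
      by auto
    have "?A *\<^sub>v unit_vec q c = 0\<^sub>v q"
    proof (rule eq_vecI)
      fix r assume r: "r < dim_vec (0\<^sub>v q :: 'k vec)"
      then have "f (\<sigma> ! r) \<noteq> c"
        using c assms by force
      then show "(?A *\<^sub>v unit_vec q c) $ r = 0\<^sub>v q $ r"
        using r row[of "unit_vec q c" r] c by auto
    qed auto
    moreover have "unit_vec q c \<noteq> (0\<^sub>v q :: 'k vec)"
      using c by (metis index_unit_vec(2) index_zero_vec(1) zero_neq_one)
    ultimately show "\<exists>v. v \<in> carrier_vec q \<and> v \<noteq> 0\<^sub>v q \<and> ?A *\<^sub>v v = 0\<^sub>v q"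
      using unit_vec_carrier by blast
  qed
  finally show ?thesis .
qed

text \<open>
  Laplace expansion along an additional column of ones; this column is the sum of the others, so
  the determinant vanishes.
\<close>

lemma orientation_cochain_cocycle:
  assumes len: "length \<rho> = Suc q" and f: "\<And>m. m \<in> set \<rho> \<Longrightarrow> f m < q"
  shows "(\<Sum>r<Suc q. (- 1) ^ r * orientation_cochain q f (drop_nth r \<rho>)) = (0::'k::field)"
proof -
  define A :: "'k mat" where
    "A = mat (Suc q) (Suc q) (\<lambda>(r, c). if c = 0 then 1 else of_bool (Suc (f (\<rho> ! r)) = c))"
  have A: "A \<in> carrier_mat (Suc q) (Suc q)"
    by (simp add: A_def)
  \<comment> \<open>The linear relation between the columns: 1 at the column of ones, -1 at the
    others.\<close>
  let ?v = "vec (Suc q) (\<lambda>c. if c = 0 then 1 else - 1) :: 'k vec"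
  have "A *\<^sub>v ?v = 0\<^sub>v (Suc q)"
  proof (rule eq_vecI)
    fix r assume r: "r < dim_vec (0\<^sub>v (Suc q) :: 'k vec)"
    then have fr: "f (\<rho> ! r) < q"
      using f len by simp
    have "(A *\<^sub>v ?v) $ r = (\<Sum>c<Suc q. A $$ (r, c) * ?v $ c)"
      using r A by (simp add: scalar_prod_def atLeast0LessThan)
    also have "\<dots> = A $$ (r, 0) * ?v $ 0 + (\<Sum>c<q. A $$ (r, Suc c) * ?v $ Suc c)"
      by (rule sum.lessThan_Suc_shift)
    also have "(\<Sum>c<q. A $$ (r, Suc c) * ?v $ Suc c) = (\<Sum>c<q. if c = f (\<rho> ! r) then - 1 else 0)"
      using r by (intro sum.cong) (auto simp: A_def)
    also have "A $$ (r, 0) * ?v $ 0 + \<dots> = 0"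
      using r fr by (simp add: A_def)
    finally show "(A *\<^sub>v ?v) $ r = 0\<^sub>v (Suc q) $ r"
      using r by simp
  qed (simp add: A_def)
  moreover have "?v \<noteq> 0\<^sub>v (Suc q)"
  proof
    assume "?v = 0\<^sub>v (Suc q)"
    then have "?v $ 0 = 0\<^sub>v (Suc q) $ 0" by (rule arg_cong)
    then show False by simp
  qed
  ultimately have "det A = 0"
    using det_0_iff_vec_prod_zero_field[OF A] vec_carrier by blast
  then have "(\<Sum>r<Suc q. A $$ (r, 0) * cofactor A r 0) = 0"
    using laplace_expansion_column[OF A, of 0] by simp
  \<comment> \<open>Deleting row \<open>r\<close> and the column of ones leaves the matrix of the
    face; the cofactor supplies the sign.\<close>
  moreover have "A $$ (r, 0) * cofactor A r 0 = (- 1) ^ r * orientation_cochain q f (drop_nth r \<rho>)"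
    if "r < Suc q" for r
  proof -
    have "mat_delete A r 0 = mat q q (\<lambda>(r', c). of_bool (f (drop_nth r \<rho> ! r') = c))"
      by (rule eq_matI) (use that len in \<open>auto simp: mat_delete_def A_def nth_drop_nth\<close>)
    then show ?thesis
      using that len by (simp add: cofactor_def orientation_cochain_def length_drop_nth A_def)
  qed
  ultimately show ?thesis
    by simp
qed

section \<open>Minimal monomial generators\<close>

lemma keys_in_span_monomials:
  assumes "p \<in> ideal.span (monom_poly ` A :: ('n, 'k::field) mpoly set)" "m \<in> Poly_Mapping.keys p"
  shows "\<exists>a\<in>A. mon_dvd a m"
  using assms
proof (induction arbitrary: m rule: ideal.span_induct_alt)
  case (step c x y)
  then obtain a where a: "a \<in> A" "x = monom_poly a"
    by blast
  from step.prems have "m \<in> Poly_Mapping.keys (c * x) \<or> m \<in> Poly_Mapping.keys y"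
    using Poly_Mapping.keys_add[of "c * x" y] by blast
  then show ?case
  proof
    assume "m \<in> Poly_Mapping.keys (c * x)"
    then obtain b where "m = b + a"
      using keys_mult[of c x] a by (auto simp: monom_poly_def)
    then have "mon_dvd a m"
      by (auto simp: mon_dvd_def add.commute)
    with a show ?thesis by blast
  qed (rule step.IH)
qed simp

lemma monom_poly_in_span_iff:
  "(monom_poly m :: ('n, 'k::field) mpoly) \<in> ideal.span (monom_poly ` A) \<longleftrightarrow> (\<exists>a\<in>A. mon_dvd a m)"
proof
  assume "(monom_poly m :: ('n, 'k) mpoly) \<in> ideal.span (monom_poly ` A)"
  then show "\<exists>a\<in>A. mon_dvd a m"
    by (rule keys_in_span_monomials) (simp add: monom_poly_def)
next
  assume "\<exists>a\<in>A. mon_dvd a m"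
  then obtain a c where a: "a \<in> A" "m = a + c"
    by (auto simp: mon_dvd_def)
  then have "monom_poly m = monom_poly c * (monom_poly a :: ('n, 'k) mpoly)"
    by (simp add: monom_poly_def mult_single add.commute)
  with a show "(monom_poly m :: ('n, 'k) mpoly) \<in> ideal.span (monom_poly ` A)"
    by (metis ideal.span_base ideal.span_scale image_eqI)
qed

text \<open>A generator that is a proper multiple of another could be dropped without changing the
  ideal.\<close>

lemma minimal_generators_antichain:
  assumes "minimal_monomial_generators M G" "a \<in> G" "b \<in> G" "mon_dvd a b"
  shows "a = b"
proof (rule ccontr)
  assume ne: "a \<noteq> b"
  have M: "M = ideal.span (monom_poly ` G)"
    using assms(1) by (simp add: minimal_monomial_generators_def)
  have "monom_poly g \<in> ideal.span (monom_poly ` (G - {b}))" if "g \<in> G" for g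
    using that ne assms(2,4) unfolding monom_poly_in_span_iff
    by (cases "g = b") (auto simp: mon_dvd_iff)
  then have "ideal.span (monom_poly ` G) \<subseteq> ideal.span (monom_poly ` (G - {b}))"
    by (intro ideal.span_minimal) auto
  moreover have "ideal.span (monom_poly ` (G - {b})) \<subseteq> ideal.span (monom_poly ` G)"
    by (intro ideal.span_mono) auto
  moreover have "G - {b} \<subset> G"
    using assms(3) by auto
  ultimately show False
    using assms(1) M unfolding minimal_monomial_generators_def by blast
qed

lemma mon_dvd_antisym: "mon_dvd a b \<Longrightarrow> mon_dvd b a \<Longrightarrow> a = b"
  by (auto simp: mon_dvd_iff intro!: poly_mapping_eqI le_antisym)

text \<open>By symmetry this is uniqueness of the minimal generators. Some \<open>h \<in> H\<close>
  divides \<open>g\<close>, and some \<open>g' \<in> G\<close> divides \<open>h\<close>; the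
  antichain property gives \<open>g' = g\<close>, hence \<open>h = g\<close>.\<close>

lemma minimal_generators_subset:
  assumes "minimal_monomial_generators M G" "minimal_monomial_generators M H"
  shows "G \<subseteq> H"
proof
  fix g assume g: "g \<in> G"
  have M: "M = ideal.span (monom_poly ` G)" "M = ideal.span (monom_poly ` H)"
    using assms by (simp_all add: minimal_monomial_generators_def)
  have "monom_poly g \<in> M"
    unfolding M(1) monom_poly_in_span_iff using g by (auto simp: mon_dvd_iff)
  then obtain h where h: "h \<in> H" "mon_dvd h g"
    unfolding M(2) monom_poly_in_span_iff by blast
  have "monom_poly h \<in> M"
    unfolding M(2) monom_poly_in_span_iff using h by (auto simp: mon_dvd_iff)
  then obtain g' where g': "g' \<in> G" "mon_dvd g' h"
    unfolding M(1) monom_poly_in_span_iff by blast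
  have "mon_dvd g' g"
    using g'(2) h(2) by (meson le_trans mon_dvd_iff)
  then have "g' = g"
    using minimal_generators_antichain assms(1) g g'(1) by blast
  then show "g \<in> H"
    using g' h mon_dvd_antisym by blast
qed

lemma one_not_minimal_generator:
  assumes "minimal_monomial_generators M G" "M \<noteq> UNIV"
  shows "0 \<notin> G"
proof
  assume "0 \<in> G"
  then have "monom_poly 0 \<in> M"
    using assms(1) by (auto simp: minimal_monomial_generators_def intro: ideal.span_base)
  then have "1 \<in> M"
    by (simp add: monom_poly_def)
  then have "p * 1 \<in> M" for p
    using assms(1) ideal.span_scale unfolding minimal_monomial_generators_def by blast
  then show False
    using assms(2) by auto
qed

section \<open>The surviving symbol\<close>

text \<open>Specialisation keeps the basis, so a symbol surviving in the specialised complex is one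
  of \<open>F\<close>.\<close>

lemma taylor_cancellations_keep_symbol:
  fixes F :: "('n::finite symbol, ('n, 'k::field) mpoly) based_complex" and z \<phi> :: "'n symbol \<Rightarrow> 'k"
  assumes "cancellation\<^sup>*\<^sup>* (taylor ms) F"
    and "\<And>\<sigma> \<tau>. \<sigma> \<in> set (subseqs ms) \<Longrightarrow> \<tau> \<in> set (subseqs ms) \<Longrightarrow> same_mdeg_on Z \<sigma> \<tau> \<Longrightarrow> P \<sigma> = P \<tau>"
    and "cycle_cocycle_pair hdeg P q (specialized_taylor Z ms) z \<phi>"
  shows "\<exists>\<sigma>\<in>basis F. hdeg \<sigma> = q \<and> P \<sigma>"
proof -
  have "cancellation\<^sup>*\<^sup>* (specialized_taylor Z ms) (map_based_complex (specialize Z) F)"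
    by (rule cancellations_map[OF specialize_1 specialize_diff specialize_mult assms(1)])
  from cancellations_keep_basis_element[OF this graded_complex_specialized_taylor assms(3)] assms(2)
  show ?thesis
    by (simp add: based_complex.map_sel)
qed

lemma filter_in_subseqs: "filter P xs \<in> set (subseqs xs)"
  by (induction xs) (auto simp: Let_def)

lemma set_of_subseqs: "\<sigma> \<in> set (subseqs ms) \<Longrightarrow> set \<sigma> \<subseteq> set ms"
  using subseqs_powset[of ms] by blast

lemma symbol_survives:
  fixes F :: "('n::finite symbol, ('n, 'k::field) mpoly) based_complex"
  assumes ms: "distinct ms" and canc: "cancellation\<^sup>*\<^sup>* (taylor ms) F"
    and le: "\<And>m x. m \<in> set ms \<Longrightarrow> expo m x \<le> \<alpha> x"
    and pos: "\<And>j. j \<in> {1..q} \<Longrightarrow> 0 < \<alpha> (i j)"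
    and d: "d ` {1..q} \<subseteq> set ms" "inj_on d {1..q}"
    and top: "\<And>j. j \<in> {1..q} \<Longrightarrow> expo (d j) (i j) = \<alpha> (i j)"
    and dom: "\<And>j k. j \<in> {1..q} \<Longrightarrow> k \<in> {1..q} \<Longrightarrow> j \<noteq> k \<Longrightarrow> expo (d j) (i k) < \<alpha> (i k)"
    and cov: "\<And>m. m \<in> set ms \<Longrightarrow> \<exists>j\<in>{1..q}. expo m (i j) = \<alpha> (i j)"
  shows "\<exists>\<sigma>\<in>basis F. hdeg \<sigma> = q \<and> \<sigma> \<in> set (subseqs ms) \<and> (\<forall>x\<in>i ` {1..q}. expo (mdeg \<sigma>) x = \<alpha> x)"
proof -
  let ?Z = "i ` {1..q}"
  \<comment> \<open>Membership in \<open>subseqs ms\<close> is part of \<open>P\<close> so that the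
    multidegree of the survivor can later be bounded in the other variables.\<close>
  define P where "P \<sigma> \<longleftrightarrow> \<sigma> \<in> set (subseqs ms) \<and> (\<forall>x\<in>?Z. expo (mdeg \<sigma>) x = \<alpha> x)" for \<sigma>
  \<comment> \<open>Indices shift by one: matrix columns count from \<open>0\<close>, while
    \<open>d\<close> and \<open>i\<close> count from \<open>1\<close>.\<close>
  have "\<forall>m\<in>set ms. \<exists>j<q. expo m (i (Suc j)) = \<alpha> (i (Suc j))"
  proof
    fix m assume "m \<in> set ms"
    then obtain j where "j \<in> {1..q}" "expo m (i j) = \<alpha> (i j)"
      using cov by blast
    then show "\<exists>j<q. expo m (i (Suc j)) = \<alpha> (i (Suc j))"
      by (intro exI[of _ "j - 1"]) auto
  qed
  then obtain f where f: "\<And>m. m \<in> set ms \<Longrightarrow> f m < q"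
    "\<And>m. m \<in> set ms \<Longrightarrow> expo m (i (Suc (f m))) = \<alpha> (i (Suc (f m)))"
    by metis
  let ?\<phi> = "orientation_cochain q f :: 'n symbol \<Rightarrow> 'k"
  define \<sigma>0 where "\<sigma>0 = filter (\<lambda>m. m \<in> d ` {1..q}) ms"
  have \<sigma>0: "\<sigma>0 \<in> set (subseqs ms)" "set \<sigma>0 = d ` {1..q}" "distinct \<sigma>0"
    using d ms by (auto simp: \<sigma>0_def filter_in_subseqs)
  have len0: "length \<sigma>0 = q"
    using \<sigma>0(2,3) d(2) by (metis card_atLeastAtMost card_image diff_Suc_1 distinct_card)
  \<comment> \<open>By dominance \<open>d j\<close> reaches the full exponent only in the variable
    \<open>i j\<close>, so \<open>f\<close> has no other choice.\<close>
  have fd: "f (d j) = j - 1" if "j \<in> {1..q}" for j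
  proof -
    have "d j \<in> set ms" using that d by blast
    then show ?thesis
      using f[of "d j"] dom[OF that, of "Suc (f (d j))"] by fastforce
  qed
  have surj0: "{..<q} \<subseteq> f ` set \<sigma>0"
  proof
    fix c assume "c \<in> {..<q}"
    then have "Suc c \<in> {1..q}" by auto
    then show "c \<in> f ` set \<sigma>0"
      unfolding \<sigma>0(2) using fd[of "Suc c"] by (metis diff_Suc_1 imageI)
  qed
  \<comment> \<open>If \<open>f\<close> hits every index, the symbol contains for each
    \<open>j\<close> a generator with full exponent in \<open>i j\<close>.\<close>
  have P_if_surj: "P \<sigma>" if \<sigma>: "\<sigma> \<in> set (subseqs ms)" "{..<q} \<subseteq> f ` set \<sigma>" for \<sigma>
    unfolding P_def
  proof (intro conjI ballI)
    fix x assume "x \<in> ?Z"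
    then obtain j where j: "j \<in> {1..q}" "x = i j" by blast
    then have "j - 1 \<in> f ` set \<sigma>" using \<sigma>(2) by auto
    then obtain m where m: "m \<in> set \<sigma>" "f m = j - 1" by auto
    have "m \<in> set ms" using m \<sigma>(1) set_of_subseqs by blast
    then have "expo m x = \<alpha> x" using f(2)[of m] m j by auto
    then have "\<alpha> x \<le> expo (mdeg \<sigma>) x" using expo_le_mdeg[OF m(1), of x] by simp
    moreover have "expo (mdeg \<sigma>) x \<le> \<alpha> x"
      using le \<sigma>(1) set_of_subseqs by (blast intro: expo_mdeg_le)
    ultimately show "expo (mdeg \<sigma>) x = \<alpha> x" by simp
  qed (rule \<sigma>(1))
  have nz: "{..<q} \<subseteq> f ` set \<sigma>" if "?\<phi> \<sigma> \<noteq> 0" for \<sigma>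
    using that
    by (metis orientation_cochain_def orientation_cochain_eq_0_iff)
  have cycle: "entry (specialized_taylor ?Z ms :: ('n symbol, 'k) based_complex) \<sigma>0 \<pi> = 0" for \<pi>
  proof (rule ccontr)
    assume "entry (specialized_taylor ?Z ms :: ('n symbol, 'k) based_complex) \<sigma>0 \<pi> \<noteq> 0"
    then obtain r where r: "r < length \<sigma>0" "\<pi> = drop_nth r \<sigma>0" "same_mdeg_on ?Z \<sigma>0 \<pi>"
      by (rule entry_specialized_taylor_nonzero)
    obtain j where j: "j \<in> {1..q}" "\<sigma>0 ! r = d j"
      using r(1) \<sigma>0(2) nth_mem by blast
    have "expo m (i j) < \<alpha> (i j)" if m: "m \<in> set \<pi>" for m
    proof -
      obtain s where s: "s < length \<sigma>0 - 1" "m = \<sigma>0 ! (if s < r then s else Suc s)"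
        using m r(1) unfolding r(2) by (auto simp: in_set_conv_nth length_drop_nth nth_drop_nth)
      then have "m \<in> set \<sigma>0" "m \<noteq> d j"
        using \<sigma>0(3) r(1) j(2)[symmetric] by (auto simp: nth_eq_iff_index_eq)
      then show ?thesis
        using dom[OF _ j(1)] unfolding \<sigma>0(2) by blast
    qed
    \<comment> \<open>The bound survives for empty \<open>\<pi>\<close>, whose multidegree is 1;
      positivity of \<open>\<alpha> (i j)\<close> makes it a strict drop.\<close>
    then have "expo (mdeg \<pi>) (i j) \<le> \<alpha> (i j) - 1"
      by (intro expo_mdeg_le) fastforce
    moreover have "expo (mdeg \<sigma>0) (i j) = \<alpha> (i j)"
      using P_if_surj[OF \<sigma>0(1) surj0] j by (auto simp: P_def)
    ultimately show False
      using r(3) pos[OF j(1)] j(1) by (auto simp: same_mdeg_on_def)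
  qed
  have cocycle: "(\<Sum>\<sigma>\<in>set (subseqs ms). entry (specialized_taylor ?Z ms) \<rho> \<sigma> * ?\<phi> \<sigma>) = 0"
    if \<rho>: "\<rho> \<in> set (subseqs ms)" for \<rho>
  proof -
    \<comment> \<open>Where the cochain is nonzero on a face, both the face and
      \<open>\<rho>\<close> lie in \<open>P\<close>. The indicator can thus be omitted, leaving the
      simplicial coboundary.\<close>
    have *: "of_bool (same_mdeg_on ?Z \<rho> (drop_nth r \<rho>)) * ?\<phi> (drop_nth r \<rho>) = ?\<phi> (drop_nth r \<rho>)" for r
    proof (cases "?\<phi> (drop_nth r \<rho>) = 0")
      case False
      then have surj: "{..<q} \<subseteq> f ` set (drop_nth r \<rho>)"
        using nz by blast
      also have "\<dots> \<subseteq> f ` set \<rho>"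
        using set_drop_nth_subset by (intro image_mono)
      finally have "P \<rho>"
        using P_if_surj \<rho> by blast
      moreover have "P (drop_nth r \<rho>)"
        using P_if_surj surj drop_nth_in_subseqs[OF \<rho>] by blast
      ultimately show ?thesis
        by (simp add: P_def same_mdeg_on_def)
    qed simp
    have "(\<Sum>\<sigma>\<in>set (subseqs ms). entry (specialized_taylor ?Z ms) \<rho> \<sigma> * ?\<phi> \<sigma>)
        = (\<Sum>r<length \<rho>. (- 1) ^ r * ?\<phi> (drop_nth r \<rho>))"
      by (simp only: specialized_taylor_coboundary[OF \<rho>] mult.assoc *)
    also have "\<dots> = 0"
    proof (cases "length \<rho> = Suc q")
      case True
      then show ?thesis
        using orientation_cochain_cocycle[OF True, of f] f(1) \<rho> set_of_subseqs by fastforce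
    next
      case False
      then show ?thesis
        by (intro sum.neutral) (auto simp: orientation_cochain_def length_drop_nth)
    qed
    finally show ?thesis .
  qed
  have "cycle_cocycle_pair hdeg P q (specialized_taylor ?Z ms) (\<lambda>\<sigma>. of_bool (\<sigma> = \<sigma>0)) ?\<phi>"
    unfolding cycle_cocycle_pair_def basis_specialized_taylor
  proof (intro conjI ballI impI)
    show "(\<Sum>\<sigma>\<in>set (subseqs ms). of_bool (\<sigma> = \<sigma>0) * ?\<phi> \<sigma>) \<noteq> 0"
      using \<sigma>0(1) surj0 orientation_cochain_eq_0_iff[OF len0, of f, where ?'k = 'k]
      by (simp add: of_bool_def if_distrib[of "\<lambda>x. x * _"] cong: if_cong)
  qed (use P_if_surj[OF \<sigma>0(1) surj0] cycle cocycle len0 in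
      \<open>auto simp: hdeg_def of_bool_def split: if_splits intro!: sum.neutral\<close>)
  from taylor_cancellations_keep_symbol[OF canc _ this]
  have "\<exists>\<sigma>\<in>basis F. hdeg \<sigma> = q \<and> P \<sigma>"
    by (auto simp: P_def same_mdeg_on_def)
  then show ?thesis
    by (simp add: P_def)
qed

text \<open>For \<open>q = 1\<close> when the variable \<open>i 1\<close> occurs in no generator, so
  that \<open>[]\<close> and \<open>[d 1]\<close> share a part. With \<open>Z = UNIV\<close> the
  parts are single multidegrees: \<open>[g]\<close> is a cycle as \<open>g\<close> is not the
  monomial 1, and its indicator is a cocycle as no two distinct generators have lcm
  \<open>g\<close>.\<close>

lemma generator_survives:
  fixes F :: "('n::finite symbol, ('n, 'k::field) mpoly) based_complex"
  assumes canc: "cancellation\<^sup>*\<^sup>* (taylor ms) F"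
    and g: "g \<in> set ms" "g \<noteq> 0"
    and min: "\<And>m. m \<in> set ms \<Longrightarrow> mon_dvd m g \<Longrightarrow> m = g"
    and ms: "distinct ms"
  shows "\<exists>\<sigma>\<in>basis F. hdeg \<sigma> = 1 \<and> \<sigma> \<in> set (subseqs ms)"
proof -
  let ?P = "\<lambda>\<sigma>. \<sigma> \<in> set (subseqs ms)"
  let ?e = "entry (specialized_taylor UNIV ms :: ('n symbol, 'k) based_complex)"
  have "filter (\<lambda>m. m = g) ms = [g]"
    using g(1) ms by (induction ms) (auto simp: filter_empty_conv)
  then have sub: "[g] \<in> set (subseqs ms)"
    by (metis filter_in_subseqs)
  have same: "mdeg \<sigma> = mdeg \<tau>" if "same_mdeg_on UNIV \<sigma> \<tau>" for \<sigma> \<tau> :: "'n symbol"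
    using that by (auto simp: same_mdeg_on_def intro: poly_mapping_eqI)
  have mdeg_g: "mdeg [g] = g"
    by (intro poly_mapping_eqI) (simp add: mdeg_def expo_mon_lcm)
  have cycle: "?e [g] \<pi> = 0" for \<pi>
  proof (rule ccontr)
    assume "?e [g] \<pi> \<noteq> 0"
    then have "\<pi> = []" "mdeg [g] = mdeg \<pi>"
      by (auto elim!: entry_specialized_taylor_nonzero dest!: same simp: drop_nth_def)
    moreover have "mdeg [] = (0 :: 'n mon)"
      by (intro poly_mapping_eqI) (simp add: mdeg_def expo_mon_lcm)
    ultimately show False
      using mdeg_g g(2) by simp
  qed
  have cocycle: "?e \<rho> [g] = 0" if \<rho>: "\<rho> \<in> set (subseqs ms)" for \<rho>
  proof (rule ccontr)
    assume "?e \<rho> [g] \<noteq> 0"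
    then obtain r where r: "r < length \<rho>" "[g] = drop_nth r \<rho>" "same_mdeg_on UNIV \<rho> [g]"
      by (rule entry_specialized_taylor_nonzero)
    have "length \<rho> = 2"
      using length_drop_nth[OF r(1)] r(1) unfolding r(2)[symmetric] by simp
    \<comment> \<open>Each generator in \<open>\<rho>\<close> divides
      \<open>mdeg \<rho> = g\<close>, so minimality leaves no room for two distinct ones.\<close>
    have "m = g" if "m \<in> set \<rho>" for m
    proof (rule min)
      show "m \<in> set ms" using that \<rho> set_of_subseqs by blast
      show "mon_dvd m g"
        using expo_le_mdeg[OF that] same[OF r(3)] mdeg_g by (simp add: mon_dvd_iff)
    qed
    then have "set \<rho> \<subseteq> {g}" by blast
    then have "card (set \<rho>) \<le> 1"
      using card_mono[of "{g}" "set \<rho>"] by simp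
    with \<open>length \<rho> = 2\<close> show False
      using subseqs_distinctD[OF \<rho> ms] by (simp add: distinct_card)
  qed
  have "cycle_cocycle_pair hdeg ?P 1 (specialized_taylor UNIV ms)
      (\<lambda>\<sigma>. of_bool (\<sigma> = [g])) (\<lambda>\<sigma>. of_bool (\<sigma> = [g]) :: 'k)"
    unfolding cycle_cocycle_pair_def basis_specialized_taylor
  proof (intro conjI ballI impI)
    show "(\<Sum>\<sigma>\<in>set (subseqs ms). of_bool (\<sigma> = [g]) * of_bool (\<sigma> = [g]) :: 'k) \<noteq> 0"
      using sub by (simp add: of_bool_def if_distrib[of "\<lambda>x. x * _"] cong: if_cong)
  qed (use cycle cocycle in \<open>auto simp: hdeg_def of_bool_def split: if_splits intro!: sum.neutral\<close>)
  from taylor_cancellations_keep_symbol[OF canc _ this] show ?thesis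
    by simp
qed

theorem lemma3p3:
  fixes M :: "('n::{finite,linorder}, 'k::field) mpoly set"
    and G :: "'n mon set"
    and F :: "('n symbol, ('n, 'k) mpoly) based_complex"
    and \<alpha> :: "'n \<Rightarrow> nat"
    and q :: nat
    and i :: "nat \<Rightarrow> 'n"
    and d :: "nat \<Rightarrow> 'n mon"
  assumes "monomial_ideal M" and "M \<noteq> {0}" and "M \<noteq> UNIV"
    and "minimal_monomial_generators M G"
    and "minimal_free_resolution M F"
    and "\<And>x. expo (mon_lcm G) x = \<alpha> x"
    and "1 \<le> q" and "q \<le> card (UNIV :: 'n set)"
    and "strict_mono_on {1..q} i"
    and "d ` {1..q} \<subseteq> G" and "card (d ` {1..q}) = q" and "dominant_set (d ` {1..q})"
    and "\<And>j. j \<in> {1..q} \<Longrightarrow> dominant_in (d ` {1..q}) (d j) (i j)"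
    and "\<And>j. j \<in> {1..q} \<Longrightarrow> expo (d j) (i j) = \<alpha> (i j)"
    and "\<And>m. m \<in> G \<Longrightarrow> \<exists>j\<in>{1..q}. mon_dvd (Poly_Mapping.single (i j) (\<alpha> (i j))) m"
  shows "\<exists>\<sigma>\<in>basis F. hdeg \<sigma> = q \<and>
           (\<forall>x. (x \<in> i ` {1..q} \<longrightarrow> expo (mdeg \<sigma>) x = \<alpha> x) \<and>
                (x \<notin> i ` {1..q} \<longrightarrow> expo (mdeg \<sigma>) x \<le> \<alpha> x))"
proof -
  obtain ms where ms: "distinct ms" "minimal_monomial_generators M (set ms)" "cancellation\<^sup>*\<^sup>* (taylor ms) F"
    using assms(5) unfolding minimal_free_resolution_def by blast
  \<comment> \<open>\<open>F\<close> comes from some enumeration of minimal generators; their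
    uniqueness identifies it with \<open>G\<close>.\<close>
  have G: "set ms = G"
    using minimal_generators_subset ms(2) assms(4) by blast
  have le: "expo m x \<le> \<alpha> x" if "m \<in> set ms" for m x
    using that unfolding assms(6)[symmetric] expo_mon_lcm G[symmetric] by simp
  have mdeg_le: "expo (mdeg \<sigma>) x \<le> \<alpha> x" if "\<sigma> \<in> set (subseqs ms)" for \<sigma> x
    using le that set_of_subseqs by (blast intro: expo_mdeg_le)
  have inj: "inj_on d {1..q}"
    using assms(11) by (intro eq_card_imp_inj_on) auto
  have dom: "expo (d j) (i k) < \<alpha> (i k)" if "j \<in> {1..q}" "k \<in> {1..q}" "j \<noteq> k" for j k
  proof -
    have "d j \<noteq> d k" using inj that by (auto dest: inj_onD)
    then show ?thesis
      using assms(13)[OF that(2)] that(1) assms(14)[OF that(2)] by (auto simp: dominant_in_def)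
  qed
  show ?thesis
  \<comment> \<open>Deleting \<open>d j\<close> leaves the part only if the lost exponent
    \<open>\<alpha> (i j)\<close> is positive, so a zero exponent is treated separately.\<close>
  proof (cases "\<forall>j\<in>{1..q}. 0 < \<alpha> (i j)")
    case True
    have "\<exists>j\<in>{1..q}. expo m (i j) = \<alpha> (i j)" if m: "m \<in> set ms" for m
    proof -
      obtain j where j: "j \<in> {1..q}" "mon_dvd (Poly_Mapping.single (i j) (\<alpha> (i j))) m"
        using assms(15) m G by blast
      then have "\<alpha> (i j) \<le> expo m (i j)"
        unfolding mon_dvd_iff by (metis lookup_single_eq)
      with le[OF m, of "i j"] j(1) show ?thesis
        by (auto intro: le_antisym)
    qed
    then have "\<exists>\<sigma>\<in>basis F. hdeg \<sigma> = q \<and> \<sigma> \<in> set (subseqs ms) \<and> (\<forall>x\<in>i ` {1..q}. expo (mdeg \<sigma>) x = \<alpha> x)"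
      using True assms(10,14) G
      by (intro symbol_survives[OF ms(1,3) le _ _ inj _ dom]) auto
    then show ?thesis
      using mdeg_le by blast
  next
    text \<open>
      If the variable \<open>i k\<close> divides no generator, dominance of \<open>d k\<close> in it forces \<open>q = 1\<close>.
    \<close>
    case False
    then obtain k where k: "k \<in> {1..q}" "\<alpha> (i k) = 0"
      by auto
    have all: "{1..q} \<subseteq> {k}"
      using dom[OF _ k(1)] k(2) by fastforce
    then have q: "q = 1" "k = 1"
      using subsetD[OF all, of 1] subsetD[OF all, of q] assms(7) by auto
    have "d 1 \<in> set ms"
      using assms(10) q G by auto
    moreover have "d 1 \<noteq> 0"
      using calculation one_not_minimal_generator[OF ms(2) assms(3)] by auto
    moreover have "m = d 1" if "m \<in> set ms" "mon_dvd m (d 1)" for m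
      using minimal_generators_antichain[OF ms(2)] that calculation(1) by blast
    ultimately have "\<exists>\<sigma>\<in>basis F. hdeg \<sigma> = 1 \<and> \<sigma> \<in> set (subseqs ms)"
      using generator_survives[OF ms(3)] ms(1) by blast
    then obtain \<sigma> where "\<sigma> \<in> basis F" "hdeg \<sigma> = 1" "\<sigma> \<in> set (subseqs ms)"
      by blast
    \<comment> \<open>Here \<open>\<alpha> (i 1) = 0\<close>, so the upper bound is already an
      equality.\<close>
    moreover have "expo (mdeg \<sigma>) (i 1) = \<alpha> (i 1)"
      using mdeg_le[of \<sigma> "i 1"] calculation(3) k q by simp
    ultimately show ?thesis
      using mdeg_le q by (intro bexI[of _ \<sigma>]) auto
  qed
qed

end
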